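(* Let $(B,\mathbf{C}^t_B)$ be a tangled closure algebra whose induced closure algebra $(B,\mathbf{C}_B)$ is dissectable. Then every finite tangled closure algebra $(A,\mathbf{C}^t_A)$ is isomorphic to a subalgebra of the relativised algebra $(B_\alpha,\mathbf{C}^t_\alpha)$ for some open element $\alpha$ of $(B,\mathbf{C}_B)$; i.e. there is an injective Boolean homomorphism $f:A\to B_\alpha$ with $f(\mathbf{C}^t_A\varGamma)=\mathbf{C}^t_\alpha\{f\gamma:\gamma\in\varGamma\}$ for all finite non-empty $\varGamma\subseteq A$.
   Context: A Boolean algebra $A$ has operations $\land,\lor,-,0,1$; $a\Rightarrow b=-a\lor b$. A closure operator on $A$ is $\mathbf{C}:A\to A$ with $\mathbf{C}(a\lor b)=\mathbf{C}a\lor\mathbf{C}b$, $\mathbf{C}0=0$, $a\leq\mathbf{C}a=\mathbf{C}\mathbf{C}a$; interior $\mathbf{I}a=-\mathbf{C}-a$; $a$ is open if $\mathbf{I}a=a$. For $\mathbf{C}^t$ from finite non-empty subsets of $A$ to $A$, the induced $\mathbf{C}a=\mathbf{C}^t\{a\}$, $\mathbf{I}a=-\mathbf{C}^t\{-a\}$; $(A,\mathbf{C}^t)$ is a tangled closure algebra if $\mathbf{C}$ is a closure operator and for all finite non-empty $\varGamma\subseteq A$ and $a\in A$: (Fix) $\mathbf{C}^t\varGamma\leq\bigwedge_{\gamma\in\varGamma}\mathbf{C}(\gamma\land\mathbf{C}^t\varGamma)$; (Ind) $\mathbf{I}(a\Rightarrow\bigwedge_{\gamma\in\varGamma}\mathbf{C}(\gamma\land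 a))\land a\leq\mathbf{C}^t\varGamma$. Relativisation to $\alpha\in B$: $B_\alpha=\{b\in B:b\leq\alpha\}$ with the same joins and meets, top $\alpha$, complement $b\mapsto\alpha\land-b$; $\mathbf{C}_\alpha b=\alpha\land\mathbf{C}_Bb$; $\mathbf{C}^t_\alpha\varGamma=\alpha\land\mathbf{C}^t_B\varGamma$. A closure algebra $(B,\mathbf{C}_B)$ is dissectable if for every non-zero open $\alpha\in B$ and all natural numbers $r,s$ there exist non-zero $\alpha_1,\dots,\alpha_r,\beta_1,\dots,\beta_s\in B$ which are pairwise disjoint with join $\alpha$, such that $\alpha_1,\dots,\alpha_r$ are open, and for all $1\le i\leq r$, $1\le j\leq s$: $\mathbf{C}_B\alpha_i\land-\alpha_i=\mathbf{C}_B\beta_j=\mathbf{C}_B\alpha\land-(\alpha_1\lor\cdots\lor\alpha_r)$ (for $r=0$ the sequence of $\alpha_i$ is empty).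
   Formalization: B is assumed non-degenerate (0 ≠ 1), since the one-element algebra is vacuously dissectable and refutes the claim; dissectability is required only for s ≥ 1 (r = s = 0 is impossible), and for r = 0 it is read as C β_j = C α for all j. *)

theory Defs
  imports Main
begin

definition closure_operator :: "('a::boolean_algebra \<Rightarrow> 'a) \<Rightarrow> bool" where
  "closure_operator C \<longleftrightarrow>
     (\<forall>a b. C (sup a b) = sup (C a) (C b)) \<and> C bot = bot \<and> (\<forall>a. a \<le> C a \<and> C a = C (C a))"

definition interior_of_closure :: "('a::boolean_algebra \<Rightarrow> 'a) \<Rightarrow> 'a \<Rightarrow> 'a" where
  "interior_of_closure C a = - C (- a)"

definition open_elem :: "('a::boolean_algebra \<Rightarrow> 'a) \<Rightarrow> 'a \<Rightarrow> bool" where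
  "open_elem C a \<longleftrightarrow> interior_of_closure C a = a"

text \<open>A tangled closure operation is modelled as a total function on sets; its values on
  empty and on infinite sets are never constrained or used.\<close>

definition induced_closure :: "('a::boolean_algebra set \<Rightarrow> 'a) \<Rightarrow> 'a \<Rightarrow> 'a" where
  "induced_closure Ct a = Ct {a}"

definition tangled_closure_algebra :: "('a::boolean_algebra set \<Rightarrow> 'a) \<Rightarrow> bool" where
  "tangled_closure_algebra Ct \<longleftrightarrow>
     (let C = induced_closure Ct; I = interior_of_closure C in
       closure_operator C \<and>
       (\<forall>\<Gamma>. finite \<Gamma> \<and> \<Gamma> \<noteq> {} \<longrightarrow>
          Ct \<Gamma> \<le> Inf_fin ((\<lambda>\<gamma>. C (inf \<gamma> (Ct \<Gamma>))) ` \<Gamma>) \<and>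
          (\<forall>a. inf (I (sup (- a) (Inf_fin ((\<lambda>\<gamma>. C (inf \<gamma> a)) ` \<Gamma>)))) a \<le> Ct \<Gamma>)))"

text \<open>Join of a finite, possibly empty, set; the empty join is \<open>bot\<close>.\<close>

definition fin_join :: "'a::boolean_algebra set \<Rightarrow> 'a" where
  "fin_join S = Sup_fin (insert bot S)"

text \<open>The number \<open>s\<close> of elements \<open>b j\<close> is positive, while \<open>r\<close> may be \<open>0\<close>: with \<open>r = s = 0\<close>
  the empty join could not equal the non-zero \<open>c\<close>. The two boundary equations are
  quantified separately, so for \<open>r = 0\<close> the condition still says that every \<open>b j\<close> has
  the same closure as \<open>c\<close>.\<close>

definition dissectable :: "('a::boolean_algebra \<Rightarrow> 'a) \<Rightarrow> bool" where
  "dissectable C \<longleftrightarrow>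
     (\<forall>c r s. c \<noteq> bot \<and> open_elem C c \<and> s \<ge> 1 \<longrightarrow>
       (\<exists>(a :: nat \<Rightarrow> 'a) (b :: nat \<Rightarrow> 'a).
          (\<forall>i\<in>{1..r}. a i \<noteq> bot \<and> open_elem C (a i)) \<and>
          (\<forall>j\<in>{1..s}. b j \<noteq> bot) \<and>
          (\<forall>i\<in>{1..r}. \<forall>i'\<in>{1..r}. i \<noteq> i' \<longrightarrow> inf (a i) (a i') = bot) \<and>
          (\<forall>j\<in>{1..s}. \<forall>j'\<in>{1..s}. j \<noteq> j' \<longrightarrow> inf (b j) (b j') = bot) \<and>
          (\<forall>i\<in>{1..r}. \<forall>j\<in>{1..s}. inf (a i) (b j) = bot) \<and>
          fin_join (a ` {1..r} \<union> b ` {1..s}) = c \<and>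
          (\<forall>i\<in>{1..r}. inf (C (a i)) (- a i) = inf (C c) (- fin_join (a ` {1..r}))) \<and>
          (\<forall>j\<in>{1..s}. C (b j) = inf (C c) (- fin_join (a ` {1..r})))))"

definition rel_carrier :: "'b::boolean_algebra \<Rightarrow> 'b set" where
  "rel_carrier \<alpha> = {b. b \<le> \<alpha>}"

definition rel_compl :: "'b::boolean_algebra \<Rightarrow> 'b \<Rightarrow> 'b" where
  "rel_compl \<alpha> b = inf \<alpha> (- b)"

definition rel_tangle :: "('b::boolean_algebra set \<Rightarrow> 'b) \<Rightarrow> 'b \<Rightarrow> 'b set \<Rightarrow> 'b" where
  "rel_tangle Ct \<alpha> \<Gamma> = inf \<alpha> (Ct \<Gamma>)"

text \<open>Boolean homomorphisms into the relativisation to \<open>\<alpha>\<close>, whose top element is \<open>\<alpha>\<close>.\<close>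

definition boolean_hom_rel :: "'b::boolean_algebra \<Rightarrow> ('a::boolean_algebra \<Rightarrow> 'b) \<Rightarrow> bool" where
  "boolean_hom_rel \<alpha> f \<longleftrightarrow>
     range f \<subseteq> rel_carrier \<alpha> \<and>
     (\<forall>x y. f (inf x y) = inf (f x) (f y)) \<and>
     (\<forall>x y. f (sup x y) = sup (f x) (f y)) \<and>
     (\<forall>x. f (- x) = rel_compl \<alpha> (f x)) \<and>
     f bot = bot \<and> f top = \<alpha>"

end

theory Submission
  imports Defs
begin

text \<open>
  Let \<open>W\<close> be the set of atoms of the finite algebra \<open>A\<close>, preordered by \<open>w R v\<close> iff \<open>w \<le> C v\<close>.
  An embedding of the closure algebra \<open>A\<close> into \<open>B\<^sub>\<alpha>\<close> is a partition of \<open>\<alpha>\<close> into non-zero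
  pieces \<open>f w\<close> such that \<open>\<alpha> \<and> C (f w)\<close> is the join of the \<open>f v\<close> with \<open>v R w\<close>. Such partitions are
  built by induction on the size of the preorder: a non-zero open \<open>\<alpha>\<close> is dissected into one open
  piece \<open>\<alpha>\<^sub>u\<close> per point \<open>u\<close> and a boundary part; each \<open>\<alpha>\<^sub>u\<close> carries a partition for the points
  strictly above \<open>u\<close>, and the boundary part inside \<open>\<alpha>\<^sub>u\<close> is divided among the cluster of \<open>u\<close>.
  The induction carries along that all pieces accumulate at the whole boundary of \<open>\<alpha>\<close>.

  An embedding of a finite closure algebra automatically preserves the tangle. Suppose that
  \<open>f w\<close> meets the tangle of \<open>f ` \<Gamma>\<close> although \<open>w\<close> is not below the tangle of \<open>\<Gamma>\<close>, and take \<open>w\<close>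
  highest possible. Some \<open>\<gamma> \<in> \<Gamma>\<close> misses the cluster of \<open>w\<close>, so the fixed-point property leads from
  \<open>w\<close> to a strictly higher \<open>v \<le> \<gamma>\<close> with the same property.
\<close>

section \<open>Finite joins and atoms\<close>

lemma fin_join_image_le_iff:
  fixes f :: "'i \<Rightarrow> 'b::boolean_algebra"
  assumes "finite S"
  shows "fin_join (f ` S) \<le> x \<longleftrightarrow> (\<forall>s\<in>S. f s \<le> x)"
  using assms unfolding fin_join_def by (subst Sup_fin.bounded_iff) auto

lemma le_fin_join_image:
  fixes f :: "'i \<Rightarrow> 'b::boolean_algebra"
  assumes "finite S" "s \<in> S"
  shows "f s \<le> fin_join (f ` S)"
  using fin_join_image_le_iff[OF assms(1), of f "fin_join (f ` S)"] assms(2) by blast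

text \<open>Residuation: meeting with \<open>x\<close> is left adjoint to joining with
  \<open>- x\<close>. Distributivity of meets over finite joins follows from it in the next
  lemma.\<close>

lemma inf_le_iff_le_sup_uminus:
  fixes x y z :: "'b::boolean_algebra"
  shows "inf x y \<le> z \<longleftrightarrow> y \<le> sup (- x) z"
  by (metis inf.commute shunt1)

lemma inf_fin_join_image_le_iff:
  fixes f :: "'i \<Rightarrow> 'b::boolean_algebra"
  assumes "finite S"
  shows "inf x (fin_join (f ` S)) \<le> y \<longleftrightarrow> (\<forall>s\<in>S. inf x (f s) \<le> y)"
  by (simp add: inf_le_iff_le_sup_uminus fin_join_image_le_iff[OF assms])

lemma fin_join_image_insert:
  fixes f :: "'i \<Rightarrow> 'b::boolean_algebra"
  assumes "finite S"
  shows "fin_join (f ` insert s S) = sup (f s) (fin_join (f ` S))"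
  by (rule antisym)
    (use assms in \<open>auto simp: fin_join_image_le_iff le_fin_join_image le_supI2 simp del: image_insert\<close>)

lemma fin_join_image_Un:
  fixes f :: "'i \<Rightarrow> 'b::boolean_algebra"
  assumes "finite S" "finite T"
  shows "fin_join (f ` (S \<union> T)) = sup (fin_join (f ` S)) (fin_join (f ` T))"
  by (rule antisym)
    (use assms in \<open>auto simp: fin_join_image_le_iff le_fin_join_image le_supI1 le_supI2\<close>)

lemma fin_join_empty [simp]: "fin_join {} = (bot :: 'b::boolean_algebra)"
  by (simp add: fin_join_def)

definition atom_set :: "'a::boolean_algebra set" where
  "atom_set = {w. w \<noteq> bot \<and> (\<forall>x. x \<le> w \<longrightarrow> x = bot \<or> x = w)}"

lemma atom_le_or_disjoint:
  assumes "w \<in> atom_set"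
  shows "w \<le> x \<or> inf w x = bot"
proof -
  have "inf w x = bot \<or> inf w x = w" using assms inf.cobounded1[of w x] by (simp add: atom_set_def)
  then show ?thesis by (metis inf.cobounded2)
qed

lemma atom_le_uminus_iff:
  assumes "w \<in> atom_set"
  shows "w \<le> - x \<longleftrightarrow> \<not> w \<le> x"
proof -
  have "w \<le> - x \<longleftrightarrow> inf w x = bot" by (simp add: inf_shunt)
  moreover have "w \<noteq> bot" using assms by (simp add: atom_set_def)
  ultimately show ?thesis
    using atom_le_or_disjoint[OF assms, of x] by (auto simp: inf.absorb1)
qed

lemma atom_le_sup_iff:
  assumes "w \<in> atom_set"
  shows "w \<le> sup x y \<longleftrightarrow> w \<le> x \<or> w \<le> y"
proof -
  have "\<not> w \<le> sup x y \<longleftrightarrow> w \<le> inf (- x) (- y)"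
    using atom_le_uminus_iff[OF assms, of "sup x y"] by simp
  then show ?thesis
    using atom_le_uminus_iff[OF assms] by auto
qed

text \<open>Atoms are join-prime. This selects a single term from a finite join, and so replaces the
  choice of a point.\<close>

lemma atom_le_fin_join_iff:
  fixes f :: "'i \<Rightarrow> 'a::boolean_algebra"
  assumes "w \<in> atom_set" "finite S"
  shows "w \<le> fin_join (f ` S) \<longleftrightarrow> (\<exists>s\<in>S. w \<le> f s)"
  using assms(2)
proof (induction S)
  case empty
  then show ?case using assms(1) by (auto simp: atom_set_def bot_unique)
next
  case (insert s S)
  then show ?case using assms(1) by (simp add: fin_join_image_insert atom_le_sup_iff del: image_insert)
qed

lemma ex_atom_le:
  fixes x :: "'a::boolean_algebra"
  assumes "finite (UNIV :: 'a set)" "x \<noteq> bot"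
  shows "\<exists>w\<in>atom_set. w \<le> x"
proof -
  have "finite {y. y \<noteq> bot \<and> y \<le> x}" using assms(1) by (rule rev_finite_subset) simp
  moreover have "x \<in> {y. y \<noteq> bot \<and> y \<le> x}" using assms(2) by simp
  ultimately obtain w where w: "w \<noteq> bot" "w \<le> x"
    and min: "\<And>y. y \<noteq> bot \<Longrightarrow> y \<le> x \<Longrightarrow> y \<le> w \<Longrightarrow> w = y"
    using finite_has_minimal2[of "{y. y \<noteq> bot \<and> y \<le> x}" x] by auto
  have "w \<in> atom_set" unfolding atom_set_def using w min order_trans by blast
  with w show ?thesis by blast
qed

lemma le_if_atoms_le:
  fixes x y :: "'a::boolean_algebra"
  assumes "finite (UNIV :: 'a set)" "\<And>w. w \<in> atom_set \<Longrightarrow> w \<le> x \<Longrightarrow> w \<le> y"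
  shows "x \<le> y"
proof (rule ccontr)
  assume "\<not> x \<le> y"
  then have "inf x (- y) \<noteq> bot" by (metis double_compl inf_shunt)
  then obtain w where "w \<in> atom_set" "w \<le> inf x (- y)" using ex_atom_le[OF assms(1)] by blast
  then show False using assms(2)[of w] atom_le_uminus_iff[of w y] by auto
qed

lemma fin_join_atoms:
  fixes x :: "'a::boolean_algebra"
  assumes "finite (UNIV :: 'a set)"
  shows "fin_join ((\<lambda>w. w) ` {w \<in> atom_set. w \<le> x}) = x"
proof -
  have fin: "finite {w \<in> atom_set. w \<le> x}" using assms by (rule rev_finite_subset) simp
  show ?thesis
  proof (rule antisym)
    show "x \<le> fin_join ((\<lambda>w. w) ` {w \<in> atom_set. w \<le> x})"
      by (rule le_if_atoms_le[OF assms]) (simp add: le_fin_join_image[OF fin, of _ "\<lambda>w. w", simplified])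
  qed (subst fin_join_image_le_iff[OF fin], simp)
qed

section \<open>Closure operators\<close>

locale closure_algebra =
  fixes C :: "'b::boolean_algebra \<Rightarrow> 'b"
  assumes closure_op: "closure_operator C"
begin

lemma C_sup: "C (sup x y) = sup (C x) (C y)"
  and C_bot: "C bot = bot"
  and le_C: "x \<le> C x"
  and C_C: "C (C x) = C x"
  using closure_op unfolding closure_operator_def by auto

lemma C_mono: "x \<le> y \<Longrightarrow> C x \<le> C y"
  by (metis C_sup le_iff_sup)

lemma C_le_C_iff: "C x \<le> C y \<longleftrightarrow> x \<le> C y"
  by (metis C_C C_mono le_C order_trans)

lemma C_fin_join_image:
  assumes "finite S"
  shows "C (fin_join (f ` S)) = fin_join ((\<lambda>s. C (f s)) ` S)"
  using assms
  by (induction S) (simp_all add: C_bot C_sup fin_join_image_insert del: image_insert)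

lemma open_elem_iff: "open_elem C c \<longleftrightarrow> C (- c) \<le> - c"
  unfolding open_elem_def interior_of_closure_def
  by (metis antisym_conv double_compl le_C)

text \<open>The closed element \<open>- c\<close> contains \<open>x\<close> and therefore its
  closure. In the gluing argument this keeps disjoint open pieces out of each other's
  closures.\<close>

lemma open_elem_disjoint_closure:
  assumes "open_elem C c" "inf c x = bot"
  shows "inf c (C x) = bot"
proof -
  have "x \<le> - c" using assms(2) inf_shunt[of x c] by (simp add: inf.commute)
  then have "C x \<le> - c" using assms(1) open_elem_iff C_mono order_trans by blast
  then show ?thesis using inf_shunt[of "C x" c] by (simp add: inf.commute)
qed

text \<open>Split \<open>x\<close> into its part in \<open>c\<close> and a part below the closed
  element \<open>- c\<close>; only the first part can contribute to the closure inside
  \<open>c\<close>. This localises closures to an open element.\<close>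

lemma open_elem_inf_closure_le:
  assumes "open_elem C c"
  shows "inf c (C x) \<le> C (inf c x)"
proof -
  have "x \<le> sup (inf c x) (- c)" by (metis inf_le_iff_le_sup_uminus order_refl sup.commute)
  then have "C x \<le> sup (C (inf c x)) (C (- c))" using C_mono C_sup by metis
  also have "\<dots> \<le> sup (C (inf c x)) (- c)"
    using assms open_elem_iff by (simp add: le_supI2)
  finally show ?thesis by (simp add: inf_le_iff_le_sup_uminus sup.commute)
qed

lemma open_elem_top: "open_elem C top"
  by (simp add: open_elem_iff C_bot)

lemma open_elem_fin_join_image:
  assumes "finite S" "\<And>s. s \<in> S \<Longrightarrow> open_elem C (f s)"
  shows "open_elem C (fin_join (f ` S))"
proof -
  have "f s \<le> - C (- fin_join (f ` S))" if "s \<in> S" for s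
  proof -
    have "C (- fin_join (f ` S)) \<le> C (- f s)"
      by (intro C_mono) (simp add: le_fin_join_image assms(1) that)
    also have "\<dots> \<le> - f s" using assms(2)[OF that] open_elem_iff by blast
    finally show ?thesis using compl_le_swap1 by blast
  qed
  then have "fin_join (f ` S) \<le> - C (- fin_join (f ` S))"
    by (simp add: fin_join_image_le_iff assms(1))
  then show ?thesis using open_elem_iff compl_le_swap1 by blast
qed

end

section \<open>Partitions realising a finite preorder\<close>

text \<open>The algebraic form of a continuous open map from \<alpha> onto \<open>U\<close> with the
  topology of \<open>R\<close>-up-sets: \<open>f u\<close> is the preimage of the point
  \<open>u\<close>, whose closure in \<open>U\<close> is the set of all \<open>v\<close> with
  \<open>R v u\<close>.\<close>

definition frame_partition ::
  "('b::boolean_algebra \<Rightarrow> 'b) \<Rightarrow> ('w \<Rightarrow> 'w \<Rightarrow> bool) \<Rightarrow> 'w set \<Rightarrow> 'b \<Rightarrow> ('w \<Rightarrow> 'b) \<Rightarrow> bool" where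
  "frame_partition C R U \<alpha> f \<longleftrightarrow>
     (\<forall>u\<in>U. f u \<noteq> bot) \<and>
     (\<forall>u\<in>U. \<forall>v\<in>U. u \<noteq> v \<longrightarrow> inf (f u) (f v) = bot) \<and>
     fin_join (f ` U) = \<alpha> \<and>
     (\<forall>u\<in>U. inf \<alpha> (C (f u)) = fin_join (f ` {v\<in>U. R v u}))"

text \<open>Transports a dissection along numberings of \<open>I\<close> and \<open>J\<close>, so
  that open pieces can be indexed by points and boundary pieces by a cluster. The condition
  \<open>s \<ge> 1\<close> becomes \<open>J \<noteq> {}\<close>, while \<open>I\<close> may be
  empty.\<close>

lemma dissectable_indexed:
  fixes C :: "'b::boolean_algebra \<Rightarrow> 'b" and I :: "'i set" and J :: "'j set"
  assumes "dissectable C" "c \<noteq> bot" "open_elem C c" "finite I" "finite J" "J \<noteq> {}"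
  obtains a :: "'i \<Rightarrow> 'b" and b :: "'j \<Rightarrow> 'b" where
    "\<And>i. i \<in> I \<Longrightarrow> a i \<noteq> bot" "\<And>i. i \<in> I \<Longrightarrow> open_elem C (a i)"
    "\<And>j. j \<in> J \<Longrightarrow> b j \<noteq> bot"
    "\<And>i i'. i \<in> I \<Longrightarrow> i' \<in> I \<Longrightarrow> i \<noteq> i' \<Longrightarrow> inf (a i) (a i') = bot"
    "\<And>j j'. j \<in> J \<Longrightarrow> j' \<in> J \<Longrightarrow> j \<noteq> j' \<Longrightarrow> inf (b j) (b j') = bot"
    "\<And>i j. i \<in> I \<Longrightarrow> j \<in> J \<Longrightarrow> inf (a i) (b j) = bot"
    "sup (fin_join (a ` I)) (fin_join (b ` J)) = c"
    "\<And>i. i \<in> I \<Longrightarrow> inf (C (a i)) (- a i) = inf (C c) (- fin_join (a ` I))"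
    "\<And>j. j \<in> J \<Longrightarrow> C (b j) = inf (C c) (- fin_join (a ` I))"
proof -
  obtain p where p: "bij_betw p I {1..card I}"
    using finite_same_card_bij[OF assms(4), of "{1..card I}"] by auto
  obtain q where q: "bij_betw q J {1..card J}"
    using finite_same_card_bij[OF assms(5), of "{1..card J}"] by auto
  have "card J \<ge> 1" using assms(5,6) by (simp add: Suc_leI card_gt_0_iff)
  then obtain a b :: "nat \<Rightarrow> 'b" where ab:
     "\<forall>i\<in>{1..card I}. a i \<noteq> bot \<and> open_elem C (a i)"
     "\<forall>j\<in>{1..card J}. b j \<noteq> bot"
     "\<forall>i\<in>{1..card I}. \<forall>i'\<in>{1..card I}. i \<noteq> i' \<longrightarrow> inf (a i) (a i') = bot"
     "\<forall>j\<in>{1..card J}. \<forall>j'\<in>{1..card J}. j \<noteq> j' \<longrightarrow> inf (b j) (b j') = bot"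
     "\<forall>i\<in>{1..card I}. \<forall>j\<in>{1..card J}. inf (a i) (b j) = bot"
     "fin_join (a ` {1..card I} \<union> b ` {1..card J}) = c"
     "\<forall>i\<in>{1..card I}. inf (C (a i)) (- a i) = inf (C c) (- fin_join (a ` {1..card I}))"
     "\<forall>j\<in>{1..card J}. C (b j) = inf (C c) (- fin_join (a ` {1..card I}))"
    using assms(1)[unfolded dissectable_def, rule_format, of c "card J" "card I"] assms(2,3)
    by blast
  have pI: "p ` I = {1..card I}" "inj_on p I" and qJ: "q ` J = {1..card J}" "inj_on q J"
    using p q by (auto simp: bij_betw_def)
  have aI: "a ` {1..card I} = (\<lambda>i. a (p i)) ` I" and bJ: "b ` {1..card J} = (\<lambda>j. b (q j)) ` J"
    unfolding pI(1)[symmetric] qJ(1)[symmetric] by (simp_all add: image_image)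
  have pin: "p i \<in> {1..card I}" if "i \<in> I" for i using pI(1) that by blast
  have qin: "q j \<in> {1..card J}" if "j \<in> J" for j using qJ(1) that by blast
  have "sup (fin_join ((\<lambda>i. a (p i)) ` I)) (fin_join ((\<lambda>j. b (q j)) ` J)) = c"
    using fin_join_image_Un[of "(\<lambda>i. a (p i)) ` I" "(\<lambda>j. b (q j)) ` J" "\<lambda>x. x"] ab(6)[unfolded aI bJ] assms(4,5)
    by simp
  then show thesis
    using ab pin qin inj_on_eq_iff[OF pI(2)] inj_on_eq_iff[OF qJ(2)]
    by (intro that[of "\<lambda>i. a (p i)" "\<lambda>j. b (q j)"]) (simp_all flip: aI)
qed

context closure_algebra
begin

lemma frame_partition_le:
  assumes "frame_partition C R U \<alpha> f" "finite U" "u \<in> U"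
  shows "f u \<le> \<alpha>"
  using assms le_fin_join_image by (auto simp: frame_partition_def)

text \<open>The cluster \<open>K\<close> of \<open>r\<close> is placed on the remainder of \<alpha>
  outside \<gamma>. Each \<open>b j\<close> is dense there, so cluster points lie below each other;
  its closure misses \<gamma>, so no point of \<open>S\<close> lies below them; and by
  \<open>bd\<close> all of the remainder lies in the closure of every piece for
  \<open>S\<close>.\<close>

lemma frame_partition_add_root_cluster:
  assumes R: "reflp R" "transp R" and U: "finite U"
    and S_def: "S = {v\<in>U. R r v \<and> \<not> R v r}" and K_def: "K = {v\<in>U. R r v \<and> R v r}"
    and f: "frame_partition C R S \<gamma> f" and "\<gamma> \<le> \<alpha>"
    and b: "\<And>j. j \<in> K \<Longrightarrow> b j \<noteq> bot" "\<And>j. j \<in> K \<Longrightarrow> C (b j) = inf (C \<alpha>) (- \<gamma>)"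
      "\<And>j j'. j \<in> K \<Longrightarrow> j' \<in> K \<Longrightarrow> j \<noteq> j' \<Longrightarrow> inf (b j) (b j') = bot"
      "fin_join (b ` K) = inf \<alpha> (- \<gamma>)"
    and bd: "\<And>u. u \<in> S \<Longrightarrow> inf (C \<alpha>) (- \<gamma>) \<le> C (f u)"
  shows "\<exists>g. frame_partition C R {v\<in>U. R r v} \<alpha> g \<and>
             (\<forall>v\<in>{v\<in>U. R r v}. inf (C \<alpha>) (- \<alpha>) \<le> C (g v))"
proof -
  define g where "g v = (if R v r then b v else f v)" for v
  have gK: "g v = b v" if "v \<in> K" for v using that by (simp add: g_def K_def)
  have gS: "g v = f v" if "v \<in> S" for v using that by (simp add: g_def S_def)
  have fin: "finite S" "finite K" using U by (simp_all add: S_def K_def)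
  have KS: "{v\<in>U. R r v} = K \<union> S" by (auto simp: K_def S_def)
  have joinK: "fin_join (g ` K) = inf \<alpha> (- \<gamma>)" using gK b(4) by (simp cong: image_cong)
  have joinS: "fin_join (g ` S) = \<gamma>" using gS f by (simp add: frame_partition_def cong: image_cong)
  have split_\<alpha>: "sup (inf \<alpha> (- \<gamma>)) \<gamma> = \<alpha>"
    using \<open>\<gamma> \<le> \<alpha>\<close> by (simp add: sup_inf_distrib2 sup_absorb1)
  have le_K: "g j \<le> inf \<alpha> (- \<gamma>)" if "j \<in> K" for j
    using le_fin_join_image[OF fin(2) that, of g] joinK by simp
  have le_S: "g u \<le> \<gamma>" if "u \<in> S" for u
    using le_fin_join_image[OF fin(1) that, of g] joinS by simp
  have KS_disj: "inf (g j) (g u) = bot" if "j \<in> K" "u \<in> S" for j u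
  proof -
    have "inf (g j) (g u) \<le> inf (inf \<alpha> (- \<gamma>)) \<gamma>" using le_K le_S that inf_mono by blast
    then show ?thesis by (simp add: inf.assoc bot_unique)
  qed
  \<comment> \<open>Above \<open>r\<close> the cluster is the lowest layer: a point of
    \<open>S\<close> below a cluster point would be below \<open>r\<close>, and each cluster point
    is below each point of \<open>S\<close>.\<close>
  have down_K: "{x \<in> K \<union> S. R x v} = K" if "v \<in> K" for v
    using that R by (auto simp: K_def S_def dest: transpD)
  have down_S: "{x \<in> K \<union> S. R x v} = K \<union> {x\<in>S. R x v}" if "v \<in> S" for v
    using that R by (auto simp: K_def S_def dest: transpD)
  have clo: "inf \<alpha> (C (g v)) = fin_join (g ` {x \<in> K \<union> S. R x v})" if "v \<in> K \<union> S" for v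
  proof (cases "v \<in> K")
    case True
    have "inf \<alpha> (C (g v)) = inf \<alpha> (- \<gamma>)"
      using True gK b(2) le_C[of \<alpha>] by (simp add: inf.absorb1 flip: inf.assoc)
    then show ?thesis using True down_K joinK by simp
  next
    case False
    then have v: "v \<in> S" using that by blast
    \<comment> \<open>The two parts of \<alpha> are treated separately: outside \<gamma> the closure
      is everything by \<open>bd\<close>, and inside \<gamma> it is given by the partition
      \<open>f\<close>.\<close>
    have "inf (inf \<alpha> (- \<gamma>)) (C (g v)) = inf \<alpha> (- \<gamma>)"
      using bd[OF v] gS[OF v] le_C[of \<alpha>]
      by (metis inf.absorb_iff1 inf_mono order_refl order_trans)
    then have "inf \<alpha> (C (g v)) = sup (inf \<alpha> (- \<gamma>)) (inf \<gamma> (C (g v)))"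
      using split_\<alpha> inf_sup_distrib2 by metis
    also have "inf \<gamma> (C (g v)) = fin_join (g ` {x\<in>S. R x v})"
    proof -
      have "f ` {x\<in>S. R x v} = g ` {x\<in>S. R x v}" by (intro image_cong) (simp_all add: gS)
      then show ?thesis using f v gS[OF v] by (simp add: frame_partition_def)
    qed
    finally show ?thesis using down_S[OF v] fin joinK by (simp add: fin_join_image_Un)
  qed
  have "frame_partition C R (K \<union> S) \<alpha> g"
    unfolding frame_partition_def
  proof (intro conjI ballI impI)
    fix u assume "u \<in> K \<union> S" then show "g u \<noteq> bot"
      using f gK gS b(1) by (auto simp: frame_partition_def)
  next
    fix u v assume "u \<in> K \<union> S" "v \<in> K \<union> S" "u \<noteq> v"
    then consider "u \<in> K" "v \<in> K" | "u \<in> S" "v \<in> S" | "u \<in> K" "v \<in> S" | "v \<in> K" "u \<in> S" by blast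
    then show "inf (g u) (g v) = bot"
      using \<open>u \<noteq> v\<close> f gK gS b(3) KS_disj
      by cases (simp_all add: frame_partition_def, metis inf.commute)
  next
    show "fin_join (g ` (K \<union> S)) = \<alpha>" using fin joinK joinS split_\<alpha> by (simp add: fin_join_image_Un)
  qed (rule clo)
  moreover have "inf (C \<alpha>) (- \<alpha>) \<le> C (g v)" if "v \<in> K \<union> S" for v
  proof -
    have "inf (C \<alpha>) (- \<alpha>) \<le> inf (C \<alpha>) (- \<gamma>)"
      using \<open>\<gamma> \<le> \<alpha>\<close> by (simp add: le_infI2)
    also have "\<dots> \<le> C (g v)" using that gK gS b(2) bd by auto
    finally show ?thesis .
  qed
  ultimately show ?thesis unfolding KS by blast
qed

text \<open>Each \<open>a u\<close> carries a copy of the points above \<open>u\<close>, and the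
  piece for \<open>v\<close> collects all copies of \<open>v\<close>. As the \<open>a u\<close> are
  open and disjoint, the closure of a copy, relative to the join of the \<open>a u\<close>, stays in
  its own \<open>a u\<close>, where \<open>g u\<close> describes it.\<close>

lemma frame_partition_glue:
  assumes R: "reflp R" "transp R" and U: "finite U"
    and a: "\<And>u. u \<in> U \<Longrightarrow> open_elem C (a u)"
      "\<And>u v. u \<in> U \<Longrightarrow> v \<in> U \<Longrightarrow> u \<noteq> v \<Longrightarrow> inf (a u) (a v) = bot"
    and g: "\<And>u. u \<in> U \<Longrightarrow> frame_partition C R {v\<in>U. R u v} (a u) (g u)"
  shows "frame_partition C R U (fin_join (a ` U)) (\<lambda>v. fin_join ((\<lambda>u. g u v) ` {u\<in>U. R u v}))"
    (is "frame_partition C R U ?\<gamma> ?F")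
proof -
  have fin: "finite {u\<in>U. P u}" for P using U by simp
  have g_le_a: "g u v \<le> a u" if "u \<in> U" "v \<in> U" "R u v" for u v
    using frame_partition_le[OF g[OF that(1)] fin, of v] that by simp
  have a_le: "a u \<le> ?\<gamma>" if "u \<in> U" for u using le_fin_join_image[OF U that] .
  have g_le_F: "g u v \<le> ?F v" if "u \<in> U" "R u v" for u v
    using le_fin_join_image[OF fin, of u "\<lambda>u. R u v" "\<lambda>u. g u v"] that by simp
  have refl: "R u u" for u using R(1) by (rule reflpD)
  have g_clo: "inf (a u) (C (g u v)) = fin_join (g u ` {x\<in>{x\<in>U. R u x}. R x v})"
    if "u \<in> U" "v \<in> U" "R u v" for u v
    using g[OF that(1)] that unfolding frame_partition_def by blast
  show ?thesis
    unfolding frame_partition_def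
  proof (intro conjI ballI impI)
    fix u assume u: "u \<in> U"
    have "g u u \<noteq> bot" using g[OF u] u refl unfolding frame_partition_def by blast
    then show "?F u \<noteq> bot" using g_le_F[OF u refl] by (metis bot_unique)
  next
    fix v v' assume v: "v \<in> U" "v' \<in> U" "v \<noteq> v'"
    have *: "inf (g u v) (g u' v') \<le> bot" if "u \<in> U" "R u v" "u' \<in> U" "R u' v'" for u u'
    proof (cases "u = u'")
      case True
      then show ?thesis using g[OF that(1)] that v unfolding frame_partition_def by auto
    next
      case False
      then show ?thesis using inf_mono[OF g_le_a g_le_a, of u v u' v'] a(2) that v by metis
    qed
    have "inf (g u' v') (g u v) \<le> bot" if "u \<in> U" "R u v" "u' \<in> U" "R u' v'" for u u'
      using *[OF that] inf.commute[of "g u v"] by simp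
    then have "\<forall>u'\<in>{u\<in>U. R u v'}. inf (g u' v') (?F v) \<le> bot"
      by (simp add: inf_fin_join_image_le_iff[OF fin])
    then have "\<forall>u'\<in>{u\<in>U. R u v'}. inf (?F v) (g u' v') \<le> bot"
      by (simp add: inf.commute)
    then have "inf (?F v) (?F v') \<le> bot" by (rule iffD2[OF inf_fin_join_image_le_iff[OF fin]])
    then show "inf (?F v) (?F v') = bot" by (simp add: bot_unique)
  next
    show "fin_join (?F ` U) = ?\<gamma>"
    proof (rule antisym)
      show "fin_join (?F ` U) \<le> ?\<gamma>"
        using order_trans[OF g_le_a a_le]
        by (auto simp: fin_join_image_le_iff[OF U] fin_join_image_le_iff[OF fin])
      have "a u \<le> fin_join (?F ` U)" if u: "u \<in> U" for u
      proof -
        have "a u = fin_join (g u ` {v\<in>U. R u v})"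
          using g[OF u] unfolding frame_partition_def by simp
        also have "\<dots> \<le> fin_join (?F ` U)"
          using order_trans[OF g_le_F[OF u] le_fin_join_image[OF U, of _ ?F]]
          by (auto simp: fin_join_image_le_iff[OF fin])
        finally show ?thesis .
      qed
      then show "?\<gamma> \<le> fin_join (?F ` U)" by (simp add: fin_join_image_le_iff[OF U])
    qed
  next
    fix v assume v: "v \<in> U"
    let ?D = "fin_join (?F ` {x\<in>U. R x v})"
    show "inf ?\<gamma> (C (?F v)) = ?D"
    proof (rule antisym)
      have "inf (a u') (C (g u v)) \<le> ?D" if "u' \<in> U" "u \<in> U" "R u v" for u u'
      proof (cases "u = u'")
        case True
        have "g u x \<le> ?D" if "x \<in> U" "R u x" "R x v" for x
          using g_le_F[OF \<open>u \<in> U\<close> that(2)] le_fin_join_image[OF fin, of x "\<lambda>x. R x v" ?F] that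
          by (simp add: order_trans)
        then have "inf (a u) (C (g u v)) \<le> ?D"
          using g_clo[OF \<open>u \<in> U\<close> v that(3)] by (simp add: fin_join_image_le_iff[OF fin])
        then show ?thesis using True by simp
      next
        case False
        then have "inf (a u') (g u v) = bot"
          using a(2)[OF that(1,2)] g_le_a[OF that(2) v that(3)]
          by (metis bot_unique inf_mono order_refl)
        then show ?thesis using open_elem_disjoint_closure a(1) that by simp
      qed
      then have "inf (a u') (C (?F v)) \<le> ?D" if "u' \<in> U" for u'
        using that by (auto simp: C_fin_join_image[OF fin] inf_fin_join_image_le_iff[OF fin])
      then have "\<forall>u'\<in>U. inf (C (?F v)) (a u') \<le> ?D" by (simp add: inf.commute)
      then have "inf (C (?F v)) ?\<gamma> \<le> ?D" by (rule iffD2[OF inf_fin_join_image_le_iff[OF U]])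
      then show "inf ?\<gamma> (C (?F v)) \<le> ?D" by (simp add: inf.commute)
    next
      have "g u x \<le> inf ?\<gamma> (C (?F v))" if "x \<in> U" "R x v" "u \<in> U" "R u x" for x u
      proof -
        \<comment> \<open>Transitivity gives \<open>v\<close> a copy in the same \<open>a u\<close>
          as this copy of \<open>x\<close>, so \<open>g u\<close> already puts the latter into the
          closure of the former.\<close>
        have Ruv: "R u v" using R(2) that transpD by metis
        have "g u x \<le> inf (a u) (C (g u v))"
          using g_clo[OF \<open>u \<in> U\<close> v Ruv] le_fin_join_image[OF fin[of "\<lambda>x. R u x \<and> R x v"], of x "g u"] that
          by simp
        also have "\<dots> \<le> inf ?\<gamma> (C (?F v))"
          using a_le[OF \<open>u \<in> U\<close>] C_mono[OF g_le_F[OF \<open>u \<in> U\<close> Ruv]] inf_mono by blast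
        finally show ?thesis .
      qed
      then show "?D \<le> inf ?\<gamma> (C (?F v))"
        by (auto simp: fin_join_image_le_iff[OF fin] simp del: le_inf_iff)
    qed
  qed
qed

text \<open>The remainder \<open>\<alpha> - \<gamma>\<close> is split into pieces \<open>b j\<close> so that, one level down, it can host a
  cluster indexed by \<open>J\<close>; every piece accumulates at the whole of \<open>C \<alpha> - \<gamma>\<close>.\<close>

lemma ex_frame_partition:
  fixes R :: "'w \<Rightarrow> 'w \<Rightarrow> bool" and U J :: "'w set"
  assumes dis: "dissectable C" and R: "reflp R" "transp R"
    and "finite U" "\<alpha> \<noteq> bot" "open_elem C \<alpha>" "finite J" "J \<noteq> {}"
  shows "\<exists>f b \<gamma>. frame_partition C R U \<gamma> f \<and> open_elem C \<gamma> \<and> \<gamma> \<le> \<alpha> \<and>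
           (\<forall>j\<in>J. b j \<noteq> bot \<and> C (b j) = inf (C \<alpha>) (- \<gamma>)) \<and>
           (\<forall>j\<in>J. \<forall>j'\<in>J. j \<noteq> j' \<longrightarrow> inf (b j) (b j') = bot) \<and>
           fin_join (b ` J) = inf \<alpha> (- \<gamma>) \<and>
           (\<forall>u\<in>U. inf (C \<alpha>) (- \<gamma>) \<le> C (f u))"
  using assms(4-8)
proof (induction "card U" arbitrary: U \<alpha> J rule: less_induct)
  case less
  note U = less.prems(1)
  obtain a b where
    a: "\<And>u. u \<in> U \<Longrightarrow> a u \<noteq> bot" "\<And>u. u \<in> U \<Longrightarrow> open_elem C (a u)"
    and b: "\<And>j. j \<in> J \<Longrightarrow> b j \<noteq> bot"
    and a_disj: "\<And>u v. u \<in> U \<Longrightarrow> v \<in> U \<Longrightarrow> u \<noteq> v \<Longrightarrow> inf (a u) (a v) = bot"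
    and b_disj: "\<And>j j'. j \<in> J \<Longrightarrow> j' \<in> J \<Longrightarrow> j \<noteq> j' \<Longrightarrow> inf (b j) (b j') = bot"
    and ab: "\<And>u j. u \<in> U \<Longrightarrow> j \<in> J \<Longrightarrow> inf (a u) (b j) = bot"
      "sup (fin_join (a ` U)) (fin_join (b ` J)) = \<alpha>"
    and bd: "\<And>u. u \<in> U \<Longrightarrow> inf (C (a u)) (- a u) = inf (C \<alpha>) (- fin_join (a ` U))"
      "\<And>j. j \<in> J \<Longrightarrow> C (b j) = inf (C \<alpha>) (- fin_join (a ` U))"
    by (rule dissectable_indexed[OF dis less.prems(2,3) U less.prems(4,5)]) (rule that; simp)
  define \<gamma> where "\<gamma> = fin_join (a ` U)"
  have "\<exists>g. frame_partition C R {v\<in>U. R u v} (a u) g \<and>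
            (\<forall>v\<in>{v\<in>U. R u v}. inf (C (a u)) (- a u) \<le> C (g v))" if u: "u \<in> U" for u
  proof -
    \<comment> \<open>Since \<open>u\<close> is not in \<open>?S\<close>, the induction hypothesis
      applies to \<open>?S\<close> inside \<open>a u\<close>. Choosing \<open>?K\<close> as its
      index set \<open>J\<close> yields the pieces for the cluster of \<open>u\<close>; this is why
      \<open>J\<close> is generalised in the induction.\<close>
    let ?S = "{v\<in>U. R u v \<and> \<not> R v u}" and ?K = "{v\<in>U. R u v \<and> R v u}"
    have uu: "R u u" using R(1) by (rule reflpD)
    have "?S \<subset> U" using u uu by blast
    then have "card ?S < card U" using U psubset_card_mono by blast
    moreover have "finite ?S" "finite ?K" "?K \<noteq> {}" using U u uu by auto
    ultimately obtain f c \<delta> where "frame_partition C R ?S \<delta> f" "open_elem C \<delta>" "\<delta> \<le> a u"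
           "\<forall>j\<in>?K. c j \<noteq> bot \<and> C (c j) = inf (C (a u)) (- \<delta>)"
           "\<forall>j\<in>?K. \<forall>j'\<in>?K. j \<noteq> j' \<longrightarrow> inf (c j) (c j') = bot"
           "fin_join (c ` ?K) = inf (a u) (- \<delta>)"
           "\<forall>v\<in>?S. inf (C (a u)) (- \<delta>) \<le> C (f v)"
      using less.hyps[of ?S "a u" ?K] a(1,2)[OF u] by blast
    then show ?thesis
      by (intro frame_partition_add_root_cluster[OF R U refl refl, of u \<delta> f "a u" c]) blast+
  qed
  then have "\<forall>u\<in>U. \<exists>g. frame_partition C R {v\<in>U. R u v} (a u) g \<and>
            (\<forall>v\<in>{v\<in>U. R u v}. inf (C (a u)) (- a u) \<le> C (g v))" by (rule ballI)
  from bchoice[OF this] obtain g where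
    g: "\<And>u. u \<in> U \<Longrightarrow> frame_partition C R {v\<in>U. R u v} (a u) (g u)"
    and g_bd: "\<And>u v. u \<in> U \<Longrightarrow> v \<in> U \<Longrightarrow> R u v \<Longrightarrow> inf (C (a u)) (- a u) \<le> C (g u v)"
    by blast
  define F where "F v = fin_join ((\<lambda>u. g u v) ` {u\<in>U. R u v})" for v
  have "frame_partition C R U \<gamma> F"
    unfolding \<gamma>_def F_def by (rule frame_partition_glue[OF R U a(2) a_disj g])
  moreover have "open_elem C \<gamma>"
    unfolding \<gamma>_def by (rule open_elem_fin_join_image[OF U a(2)])
  moreover have "\<gamma> \<le> \<alpha>" using ab(2) unfolding \<gamma>_def by (metis sup_ge1)
  moreover have "fin_join (b ` J) = inf \<alpha> (- \<gamma>)"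
  proof -
    have "inf (b j) \<gamma> \<le> bot" if "j \<in> J" for j
      unfolding \<gamma>_def using ab(1) that by (subst inf_fin_join_image_le_iff[OF U]) (simp add: inf.commute)
    then have "inf \<gamma> (fin_join (b ` J)) \<le> bot"
      using inf_fin_join_image_le_iff[OF less.prems(4)] by (metis inf.commute)
    then have "fin_join (b ` J) \<le> - \<gamma>" by (simp add: inf_le_iff_le_sup_uminus)
    then show ?thesis
      using ab(2) unfolding \<gamma>_def[symmetric]
      by (metis boolean_algebra.conj_cancel_right inf.absorb1 inf_sup_distrib2 sup_bot.left_neutral)
  qed
  \<comment> \<open>\<open>F u\<close> contains \<open>g u u\<close>, which accumulates at the whole
    boundary of \<open>a u\<close>. By the dissection this boundary is
    \<open>inf (C \<alpha>) (- \<gamma>)\<close>, the same for every \<open>u\<close>.\<close>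
  moreover have "inf (C \<alpha>) (- \<gamma>) \<le> C (F u)" if u: "u \<in> U" for u
  proof -
    have uu: "R u u" using R(1) by (rule reflpD)
    have "g u u \<le> F u"
      unfolding F_def using le_fin_join_image[of "{x\<in>U. R x u}" u "\<lambda>x. g x u"] u uu U by simp
    then show ?thesis using g_bd[OF u u uu] bd(1)[OF u] C_mono order_trans unfolding \<gamma>_def by metis
  qed
  ultimately show ?case using b b_disj bd(2) unfolding \<gamma>_def by blast
qed

end

section \<open>From partitions to embeddings\<close>

text \<open>The map sends \<open>x\<close> to the join of the pieces of its atoms. Disjointness of
  the pieces and their join \<alpha> make it a Boolean homomorphism, non-zero pieces make it
  injective. Closures are additive, so they need comparing only on atoms, where
  \<open>frame_partition\<close> gives the equation.\<close>

lemma ex_closure_embedding: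
  fixes CA :: "'a::boolean_algebra \<Rightarrow> 'a" and CB :: "'b::boolean_algebra \<Rightarrow> 'b"
  assumes fin: "finite (UNIV :: 'a set)" and "closure_operator CA" "closure_operator CB"
    and g: "frame_partition CB (\<lambda>w v. w \<le> CA v) atom_set \<alpha> g"
  shows "\<exists>f. inj f \<and> boolean_hom_rel \<alpha> f \<and> (\<forall>x. f (CA x) = inf \<alpha> (CB (f x)))"
proof -
  define f where "f x = fin_join (g ` {w\<in>atom_set. w \<le> x})" for x
  interpret A: closure_algebra CA by unfold_locales fact
  interpret B: closure_algebra CB by unfold_locales fact
  have finS: "finite S" for S :: "'a set" using fin by (rule rev_finite_subset) simp
  have le_f: "g w \<le> f x" if "w \<in> atom_set" "w \<le> x" for w x
    unfolding f_def using le_fin_join_image[OF finS, of w "{w\<in>atom_set. w \<le> x}" g] that by simp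
  have f_le_iff: "f x \<le> y \<longleftrightarrow> (\<forall>w\<in>atom_set. w \<le> x \<longrightarrow> g w \<le> y)" for x y
    unfolding f_def by (auto simp: fin_join_image_le_iff[OF finS])
  have inf_f_le_iff: "inf y (f x) \<le> z \<longleftrightarrow> (\<forall>w\<in>atom_set. w \<le> x \<longrightarrow> inf y (g w) \<le> z)" for x y z
    unfolding f_def by (auto simp: inf_fin_join_image_le_iff[OF finS])
  have g_nz: "g w \<noteq> bot" if "w \<in> atom_set" for w
    using g that unfolding frame_partition_def by blast
  have g_disj: "inf (g w) (g v) = bot" if "w \<in> atom_set" "v \<in> atom_set" "w \<noteq> v" for w v
    using g that unfolding frame_partition_def by blast
  have g_f_disj: "inf (g w) (f x) = bot" if "w \<in> atom_set" "\<not> w \<le> x" for w x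
    using that g_disj inf_f_le_iff[of "g w" x bot] by (metis bot_unique order_refl)
  have f_mono: "f x \<le> f y" if "x \<le> y" for x y
    using that le_f f_le_iff order_trans by metis
  have f_top: "f top = \<alpha>" using g unfolding f_def frame_partition_def by simp
  have f_bot: "f bot = bot"
    using f_le_iff[of bot bot] by (auto simp: bot_unique atom_set_def)
  have f_inf: "f (inf x y) = inf (f x) (f y)" for x y
  proof (rule antisym)
    have "inf (f x) (g w) \<le> f (inf x y)" if "w \<in> atom_set" "w \<le> y" for w
      using g_f_disj[OF that(1), of x] le_f[OF that(1), of "inf x y"] that(2)
      by (metis inf.cobounded2 inf.commute le_inf_iff bot_least order_trans)
    then show "inf (f x) (f y) \<le> f (inf x y)" using inf_f_le_iff by blast
  qed (simp add: f_mono)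
  have f_sup: "f (sup x y) = sup (f x) (f y)" for x y
  proof (rule antisym)
    show "f (sup x y) \<le> sup (f x) (f y)"
      using le_f by (auto simp: f_le_iff atom_le_sup_iff le_supI1 le_supI2)
  qed (simp add: f_mono)
  have f_compl: "f (- x) = inf \<alpha> (- f x)" for x
  proof -
    have "sup (f x) (f (- x)) = \<alpha>" "inf (f x) (f (- x)) = bot"
      using f_sup[of x "- x"] f_inf[of x "- x"] f_top f_bot by simp_all
    then show ?thesis
      using inf_sup_distrib2[of "f x" "f (- x)" "- f x"] inf_shunt[of "f (- x)" "f x"]
      by (simp add: inf.commute inf.absorb2)
  qed
  have "x \<le> y" if "f x \<le> f y" for x y
  proof (rule le_if_atoms_le[OF fin], rule ccontr)
    fix w assume w: "w \<in> atom_set" "w \<le> x" "\<not> w \<le> y"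
    have "g w \<le> f y" using le_f[OF w(1,2)] that by (rule order_trans)
    then show False using g_f_disj[OF w(1,3)] g_nz[OF w(1)] by (simp add: inf.absorb1)
  qed
  then have "inj f" by (intro injI antisym) simp_all
  moreover have "boolean_hom_rel \<alpha> f"
    unfolding boolean_hom_rel_def rel_carrier_def rel_compl_def
    using f_inf f_sup f_compl f_bot f_top f_mono[OF top_greatest] by auto
  moreover have "f (CA x) = inf \<alpha> (CB (f x))" for x
  proof (rule antisym)
    have "inf \<alpha> (CB (g v)) \<le> f (CA x)" if v: "v \<in> atom_set" "v \<le> x" for v
    proof -
      have "inf \<alpha> (CB (g v)) = fin_join (g ` {w\<in>atom_set. w \<le> CA v})"
        using g v(1) unfolding frame_partition_def by blast
      also have "\<dots> \<le> f (CA x)"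
        using f_mono[OF A.C_mono[OF v(2)]] by (simp add: f_def)
      finally show ?thesis .
    qed
    then show "inf \<alpha> (CB (f x)) \<le> f (CA x)"
      by (auto simp: f_def B.C_fin_join_image[OF finS] inf_fin_join_image_le_iff[OF finS])
    have "g w \<le> inf \<alpha> (CB (f x))" if w: "w \<in> atom_set" "w \<le> CA x" for w
    proof -
      \<comment> \<open>By additivity \<open>CA x\<close> is the join of the closures of the atoms
        below \<open>x\<close>, and the atom \<open>w\<close> must lie below one of these.\<close>
      have "w \<le> fin_join ((\<lambda>v. CA v) ` {v\<in>atom_set. v \<le> x})"
        using w(2) fin_join_atoms[OF fin, of x] A.C_fin_join_image[OF finS, of "\<lambda>v. v" "{v\<in>atom_set. v \<le> x}"]
        by simp
      then obtain v where v: "v \<in> atom_set" "v \<le> x" "w \<le> CA v"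
        unfolding atom_le_fin_join_iff[OF w(1) finS] by blast
      have "g w \<le> fin_join (g ` {w\<in>atom_set. w \<le> CA v})"
        using le_fin_join_image[OF finS, of w "{w\<in>atom_set. w \<le> CA v}" g] w(1) v(3) by simp
      also have "\<dots> = inf \<alpha> (CB (g v))" using g v(1) unfolding frame_partition_def by simp
      also have "\<dots> \<le> inf \<alpha> (CB (f x))" using B.C_mono[OF le_f[OF v(1,2)]] inf_mono by blast
      finally show ?thesis .
    qed
    then show "f (CA x) \<le> inf \<alpha> (CB (f x))" unfolding f_le_iff by simp
  qed
  ultimately show ?thesis by (intro exI[of _ f]) simp
qed

section \<open>Tangles\<close>

lemma tangled_closure_algebra_closure:
  "tangled_closure_algebra Ct \<Longrightarrow> closure_operator (induced_closure Ct)"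
  unfolding tangled_closure_algebra_def by (simp add: Let_def)

lemma tangle_fix:
  assumes "tangled_closure_algebra Ct" "finite \<Gamma>" "\<gamma> \<in> \<Gamma>"
  shows "Ct \<Gamma> \<le> induced_closure Ct (inf \<gamma> (Ct \<Gamma>))"
proof -
  have "Ct \<Gamma> \<le> Inf_fin ((\<lambda>\<gamma>. induced_closure Ct (inf \<gamma> (Ct \<Gamma>))) ` \<Gamma>)"
    using assms unfolding tangled_closure_algebra_def Let_def by blast
  also have "\<dots> \<le> induced_closure Ct (inf \<gamma> (Ct \<Gamma>))"
    using assms by (intro Inf_fin.coboundedI) auto
  finally show ?thesis .
qed

text \<open>The hypothesis turns the implication in (Ind) into \<open>top\<close>, whose interior is
  \<open>top\<close>. Together with \<open>tangle_fix\<close> this makes the tangle the greatest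
  post-fixed point.\<close>

lemma tangle_greatest:
  assumes "tangled_closure_algebra Ct" "finite \<Gamma>" "\<Gamma> \<noteq> {}"
    and "\<And>\<gamma>. \<gamma> \<in> \<Gamma> \<Longrightarrow> a \<le> induced_closure Ct (inf \<gamma> a)"
  shows "a \<le> Ct \<Gamma>"
proof -
  let ?C = "induced_closure Ct" and ?m = "Inf_fin ((\<lambda>\<gamma>. induced_closure Ct (inf \<gamma> a)) ` \<Gamma>)"
  interpret closure_algebra ?C
    by unfold_locales (rule tangled_closure_algebra_closure[OF assms(1)])
  have "a \<le> ?m" using assms(2-4) by (intro Inf_fin.boundedI) auto
  then have "sup (- a) ?m = top" by (metis double_compl sup_shunt)
  then have "interior_of_closure ?C (sup (- a) ?m) = top"
    by (simp add: interior_of_closure_def C_bot)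
  moreover have "inf (interior_of_closure ?C (sup (- a) ?m)) a \<le> Ct \<Gamma>"
    using assms(1-3) unfolding tangled_closure_algebra_def Let_def by blast
  ultimately show ?thesis by simp
qed

text \<open>The closure of the tangle is again a post-fixed point, hence below the greatest
  one.\<close>

lemma closure_tangle_le:
  assumes "tangled_closure_algebra Ct" "finite \<Gamma>" "\<Gamma> \<noteq> {}"
  shows "induced_closure Ct (Ct \<Gamma>) \<le> Ct \<Gamma>"
proof (rule tangle_greatest[OF assms])
  interpret closure_algebra "induced_closure Ct"
    by unfold_locales (rule tangled_closure_algebra_closure[OF assms(1)])
  fix \<gamma> assume "\<gamma> \<in> \<Gamma>"
  then have "Ct \<Gamma> \<le> induced_closure Ct (inf \<gamma> (Ct \<Gamma>))" using tangle_fix assms by blast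
  also have "\<dots> \<le> induced_closure Ct (inf \<gamma> (induced_closure Ct (Ct \<Gamma>)))"
    by (intro C_mono inf_mono order_refl le_C)
  finally show "induced_closure Ct (Ct \<Gamma>) \<le> induced_closure Ct (inf \<gamma> (induced_closure Ct (Ct \<Gamma>)))"
    by (simp add: C_le_C_iff)
qed

text \<open>The image of the tangle is a post-fixed point in \<open>B\<close>, which gives one
  inequality. For the other, the pieces \<open>f w\<close> of the atoms cover \<alpha>, so it
  suffices that every atom whose piece meets \<open>y\<close> lies below \<open>t\<close>.\<close>

lemma closure_hom_preserves_tangle:
  fixes CtB :: "'b::boolean_algebra set \<Rightarrow> 'b" and CtA :: "'a::boolean_algebra set \<Rightarrow> 'a"
  assumes tB: "tangled_closure_algebra CtB" and tA: "tangled_closure_algebra CtA"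
    and fin: "finite (UNIV :: 'a set)" and op: "open_elem (induced_closure CtB) \<alpha>"
    and hom: "boolean_hom_rel \<alpha> f"
    and clo: "\<And>x. f (induced_closure CtA x) = inf \<alpha> (induced_closure CtB (f x))"
    and \<Gamma>: "\<Gamma> \<noteq> {}"
  shows "f (CtA \<Gamma>) = rel_tangle CtB \<alpha> (f ` \<Gamma>)"
proof -
  let ?CA = "induced_closure CtA" and ?CB = "induced_closure CtB"
  interpret A: closure_algebra ?CA
    by unfold_locales (rule tangled_closure_algebra_closure[OF tA])
  interpret B: closure_algebra ?CB
    by unfold_locales (rule tangled_closure_algebra_closure[OF tB])
  have finS: "finite S" for S :: "'a set" using fin by (rule rev_finite_subset) simp
  have f_inf: "f (inf x y) = inf (f x) (f y)" and f_sup: "f (sup x y) = sup (f x) (f y)"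
    and f_bot: "f bot = bot" and f_top: "f top = \<alpha>" and f_le: "f x \<le> \<alpha>" for x y
    using hom unfolding boolean_hom_rel_def rel_carrier_def by auto
  have f_mono: "f x \<le> f y" if "x \<le> y" for x y using that f_sup by (metis le_iff_sup)
  have f_join: "f (fin_join (h ` S)) = fin_join ((\<lambda>s. f (h s)) ` S)" for h :: "'a \<Rightarrow> 'a" and S
    using finS[of S]
    by (induction S) (simp_all add: f_bot f_sup fin_join_image_insert del: image_insert)
  have f_atoms: "f x = fin_join (f ` {w\<in>atom_set. w \<le> x})" for x
    using f_join[of "\<lambda>w. w" "{w\<in>atom_set. w \<le> x}"] fin_join_atoms[OF fin, of x] by simp
  define t where "t = CtA \<Gamma>"
  define y where "y = inf \<alpha> (CtB (f ` \<Gamma>))"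
  have "f t \<le> CtB (f ` \<Gamma>)"
  proof (rule tangle_greatest[OF tB])
    fix \<delta> assume "\<delta> \<in> f ` \<Gamma>"
    then obtain \<gamma> where \<gamma>: "\<gamma> \<in> \<Gamma>" "\<delta> = f \<gamma>" by blast
    have "f t \<le> f (?CA (inf \<gamma> t))"
      using f_mono tangle_fix[OF tA finS \<gamma>(1)] unfolding t_def by blast
    then show "f t \<le> ?CB (inf \<delta> (f t))" by (simp add: clo f_inf \<gamma>(2))
  qed (use \<Gamma> finS in auto)
  then have "f t \<le> y" using f_le by (simp add: y_def)
  moreover have "w \<le> t" if "w \<in> atom_set" "inf y (f w) \<noteq> bot" for w
    using that
  \<comment> \<open>The measure counts the elements whose closure contains \<open>w\<close>; it
    drops when \<open>w\<close> is replaced by a strictly higher atom.\<close>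
  proof (induction "card {v. w \<le> ?CA v}" arbitrary: w rule: less_induct)
    case less
    note w = less.prems(1)
    show ?case
    proof (rule ccontr)
      assume nt: "\<not> w \<le> t"
      define K where "K = {v\<in>atom_set. w \<le> ?CA v \<and> v \<le> ?CA w}"
      define k where "k = fin_join ((\<lambda>v. v) ` K)"
      have le_k: "v \<le> k" if "v \<in> K" for v
        unfolding k_def using le_fin_join_image[OF finS that, of "\<lambda>v. v"] .
      have "w \<in> K" using w A.le_C by (simp add: K_def)
      then have "\<not> k \<le> t" using nt le_k order_trans by blast
      \<comment> \<open>As \<open>k\<close> is not below the greatest post-fixed point, it is not
        post-fixed, and some member of \<Gamma> witnesses this.\<close>
      then obtain \<gamma> where \<gamma>: "\<gamma> \<in> \<Gamma>" "\<not> k \<le> ?CA (inf \<gamma> k)"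
        using tangle_greatest[OF tA finS \<Gamma>] unfolding t_def by blast
      \<comment> \<open>Points of a cluster lie in each other's closures, so a single one below
        \<gamma> would put all of \<open>k\<close> into the closure of
        \<open>inf \<gamma> k\<close>.\<close>
      have miss: "\<not> v \<le> \<gamma>" if v: "v \<in> K" for v
      proof
        assume "v \<le> \<gamma>"
        then have "?CA v \<le> ?CA (inf \<gamma> k)" using le_k[OF v] by (simp add: A.C_mono)
        then have "?CA w \<le> ?CA (inf \<gamma> k)"
          using v unfolding K_def A.C_le_C_iff[of w] by (blast intro: order_trans)
        then have "k \<le> ?CA (inf \<gamma> k)"
          unfolding k_def K_def by (subst fin_join_image_le_iff[OF finS]) (auto intro: order_trans)
        with \<gamma>(2) show False by blast
      qed
      \<comment> \<open>Openness of \<alpha> lets the fixed-point property in \<open>B\<close> be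
        cut down to \<alpha>, with the meet moved inside the closure.\<close>
      have "y \<le> ?CB (inf \<alpha> (inf (f \<gamma>) (CtB (f ` \<Gamma>))))"
        using tangle_fix[OF tB, of "f ` \<Gamma>" "f \<gamma>"] \<gamma>(1) finS[of \<Gamma>]
          B.open_elem_inf_closure_le[OF op, of "inf (f \<gamma>) (CtB (f ` \<Gamma>))"]
        unfolding y_def by (meson finite_imageI imageI inf_mono order_refl order_trans)
      then have y_le: "y \<le> ?CB (inf y (f \<gamma>))" by (simp add: y_def ac_simps)
      \<comment> \<open>The part of \<open>y\<close> in \<open>f \<gamma>\<close> is a finite join
        over the atoms below \<gamma>. As \<open>f w\<close> meets its closure, it meets the closure
        of one of the terms.\<close>
      have "\<exists>v\<in>atom_set. v \<le> \<gamma> \<and> inf (f w) (?CB (inf y (f v))) \<noteq> bot"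
      proof (rule ccontr)
        assume "\<not> ?thesis"
        then have *: "inf (f w) (?CB (inf y (f v))) = bot" if "v \<in> atom_set" "v \<le> \<gamma>" for v
          using that by blast
        have "inf y (f \<gamma>) \<le> fin_join ((\<lambda>v. inf y (f v)) ` {v\<in>atom_set. v \<le> \<gamma>})"
          unfolding f_atoms[of \<gamma>] inf_fin_join_image_le_iff[OF finS]
          by (intro ballI le_fin_join_image[OF finS, of _ _ "\<lambda>v. inf y (f v)"])
        then have "y \<le> ?CB (fin_join ((\<lambda>v. inf y (f v)) ` {v\<in>atom_set. v \<le> \<gamma>}))"
          using y_le B.C_mono order_trans by blast
        then have "inf (f w) y \<le> inf (f w) (fin_join ((\<lambda>v. ?CB (inf y (f v))) ` {v\<in>atom_set. v \<le> \<gamma>}))"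
          unfolding B.C_fin_join_image[OF finS] using inf_mono by blast
        also have "\<dots> \<le> bot" using * by (auto simp: inf_fin_join_image_le_iff[OF finS])
        finally show False using less.prems(2) by (simp add: bot_unique inf.commute)
      qed
      then obtain v where v: "v \<in> atom_set" "v \<le> \<gamma>" "inf (f w) (?CB (inf y (f v))) \<noteq> bot" by blast
      \<comment> \<open>Contact between pieces is pulled back along \<open>f\<close>:
        \<open>w\<close> meets \<open>?CA v\<close> and, being an atom, lies below it. Since
        \<open>v\<close> is below \<gamma>, it is outside the cluster and thus strictly
        higher.\<close>
      have "inf (f w) (?CB (inf y (f v))) \<le> inf (f w) (inf \<alpha> (?CB (f v)))"
        using f_le[of w] B.C_mono[of "inf y (f v)" "f v"] by (simp add: le_infI1 le_infI2)
      also have "\<dots> = f (inf w (?CA v))" by (simp add: f_inf clo)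
      finally have "inf w (?CA v) \<noteq> bot" using v(3) f_bot by (metis bot_unique)
      then have wv: "w \<le> ?CA v" using atom_le_or_disjoint[OF w] by blast
      then have nvw: "\<not> v \<le> ?CA w" using miss v(1,2) unfolding K_def by blast
      have "{x. v \<le> ?CA x} \<subset> {x. w \<le> ?CA x}"
        using wv nvw A.le_C[of w] A.C_le_C_iff order_trans by blast
      then have "card {x. v \<le> ?CA x} < card {x. w \<le> ?CA x}" using finS psubset_card_mono by blast
      moreover have "inf y (f v) \<noteq> bot" using v(3) B.C_bot by auto
      ultimately have "v \<le> t" using less.hyps v(1) by blast
      then have "w \<le> t"
        using wv A.C_mono closure_tangle_le[OF tA finS \<Gamma>] unfolding t_def by (meson order_trans)
      with nt show False ..
    qed
  qed
  then have "inf y (f w) \<le> f t" if "w \<in> atom_set" for w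
    using that f_mono by (metis bot_least inf.cobounded2 order_trans)
  then have "inf y (f top) \<le> f t"
    by (subst f_atoms) (simp add: inf_fin_join_image_le_iff[OF finS])
  then have "y \<le> f t" by (simp add: f_top y_def inf.absorb1 inf.commute inf.left_commute)
  ultimately have "f t = y" by (rule antisym)
  then show ?thesis by (simp add: t_def y_def rel_tangle_def)
qed

theorem theorem4p2:
  fixes CtB :: "'b::boolean_algebra set \<Rightarrow> 'b"
    and CtA :: "'a::boolean_algebra set \<Rightarrow> 'a"
  assumes "(bot :: 'b) \<noteq> top"
    and "tangled_closure_algebra CtB"
    and "dissectable (induced_closure CtB)"
    and "tangled_closure_algebra CtA"
    and "finite (UNIV :: 'a set)"
  shows "\<exists>\<alpha> f. open_elem (induced_closure CtB) \<alpha> \<and>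
           inj f \<and> boolean_hom_rel \<alpha> f \<and>
           (\<forall>\<Gamma>. finite \<Gamma> \<and> \<Gamma> \<noteq> {} \<longrightarrow> f (CtA \<Gamma>) = rel_tangle CtB \<alpha> (f ` \<Gamma>))"
proof -
  let ?CA = "induced_closure CtA" and ?CB = "induced_closure CtB"
  note cA = tangled_closure_algebra_closure[OF assms(4)]
    and cB = tangled_closure_algebra_closure[OF assms(2)]
  interpret A: closure_algebra ?CA by unfold_locales (rule cA)
  interpret B: closure_algebra ?CB by unfold_locales (rule cB)
  have "reflp (\<lambda>w v. w \<le> ?CA v)" by (rule reflpI) (rule A.le_C)
  moreover have "transp (\<lambda>w v. w \<le> ?CA v)"
    by (rule transpI) (use A.C_le_C_iff order_trans in blast)
  moreover have "finite (atom_set :: 'a set)" using assms(5) by (rule rev_finite_subset) simp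
  \<comment> \<open>The construction starts from \<open>top\<close>, non-zero by the first
    assumption. Only the partitioned open part is kept, so a one-element index set serves for the
    remainder. For a trivial \<open>A\<close> there are no atoms and \<alpha> is
    \<open>bot\<close>.\<close>
  ultimately obtain g \<alpha> where g: "frame_partition ?CB (\<lambda>w v. w \<le> ?CA v) atom_set \<alpha> g"
    and \<alpha>: "open_elem ?CB \<alpha>"
    using B.ex_frame_partition[OF assms(3), of "\<lambda>w v. w \<le> ?CA v" atom_set top "{undefined}"]
      assms(1) B.open_elem_top by auto
  obtain f where f: "inj f" "boolean_hom_rel \<alpha> f" "\<And>x. f (?CA x) = inf \<alpha> (?CB (f x))"
    using ex_closure_embedding[OF assms(5) cA cB g] by blast
  show ?thesis
  proof (intro exI conjI allI impI)
    fix \<Gamma> :: "'a set" assume "finite \<Gamma> \<and> \<Gamma> \<noteq> {}"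
    then show "f (CtA \<Gamma>) = rel_tangle CtB \<alpha> (f ` \<Gamma>)"
      using closure_hom_preserves_tangle[OF assms(2,4,5) \<alpha> f(2,3)] by simp
  qed (fact \<alpha> f)+
qed

end
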